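(* Let $\Theta_0\subseteq\Theta$ and $\alpha\in(0,1)$, and let $S_n$ be the cross-fit likelihood-ratio statistic for the null hypothesis $H_0:\theta\in\Theta_0$ defined in the context. Suppose that (i) $(Y_i,X_i,U_i)$, $i=1,\dots,n$, are independently distributed across $i$, and (ii) $(X_i,U_i)$, $i=1,\dots,n$, are identically distributed (the laws of the $Y_i$ may differ across $i$). Then, for any $n\in\mathbb N$, $$\sup_{P^n\in\mathcal P^n_0}P^n\Big(S_n>\frac1\alpha\Big)\le\alpha .$$
   Context: **Model.** $\mathcal Y\subseteq\mathbb R^{d_Y}$ is a finite set, $\mathcal X\subseteq\mathbb R^{d_X}$, $\mathcal U\subseteq\mathbb R^{d_U}$, $\mathcal Z=\mathcal Y\times\mathcal X$, and $\Theta$ is an arbitrary (unrestricted) parameter set. $Y\in\mathcal Y$ and $X\in\mathcal X$ are observed, and $U\in\mathcal U$ is latent. For each $\theta\in\Theta$, $F_\theta(\cdot|x)$ is a conditional distribution of $U$ given $X=x$, and $G(\cdot|\cdot;\theta):\mathcal U\times\mathcal X\twoheadrightarrow\mathcal Y$ is a weakly measurable (nonempty-valued) correspondence. The model asserts only $Y\in G(U|X;\theta)$ a.s. For $A\subseteq\mathcal Y$ define the containment functional $$\nu_\theta(A|x)=\int 1\{G(u|x;\theta)\subseteq A\}\,dF_\theta(u|x).$$ Let $\mathcal P_{\theta,x}$ be the set of probability distributions $Q(\cdot|x)$ on $\mathcal Y$ with $Q(A|x)\ge\nu_\theta(A|x)$ for all $A\subseteq\mathcal Y$, and let $\mathfrak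 q_{\theta,x}$ be the set of probability mass functions on $\mathcal Y$ of the elements of $\mathcal P_{\theta,x}$. **Data-generating processes.** $\Delta(\mathcal Z^n)$ is the set of Borel probability measures on $\mathcal Z^n$. For $\theta\in\Theta$, $$\mathcal P^n_\theta=\Big\{P^n\in\Delta(\mathcal Z^n):P^n=\bigotimes_{i=1}^nP_i,\ P_i(\cdot|x)\in\mathcal P_{\theta,x}\ \ \forall i,\ \forall x\in\mathcal X\Big\},$$ where $P_i(\cdot|x)$ is the conditional law of $Y_i$ given $X_i=x$ under $P_i$. $\mathcal P_0^n=\{P^n\in\mathcal P^n_\theta:\theta\in\Theta_0\}=\bigcup_{\theta\in\Theta_0}\mathcal P^n_\theta$. **Test statistic.** The sample is $(Y_i,X_i)$, $i=1,\dots,n$. The index set $\{1,\dots,n\}$ is split, without reference to the data, into two disjoint subsets $D_0,D_1$ with union $\{1,\dots,n\}$. 1. $\hat\theta_1$ is any $\Theta$-valued estimator computed from the observations in $D_1$ only. For each $x$, $p(\cdot|x)\in\mathfrak q_{\hat\theta_1,x}$ is any selected element with $p(y|x)>0$ for all $y\in\mathcal Y$ (a function of the $D_1$ data only). Set $q_{\hat\theta_1}(\cdot|x)=p(\cdot|x)$ in the numerator below. 2. For each $\theta\in\Theta_0$ and $x\in\mathcal X$, the LFP-based density is $$q_\theta(\cdot|x)=\operatorname*{arg\,min}_{q(\cdot|x)\in\mathfrak q_{\theta,x}}\ \sum_{y\in\mathcal Y}\ln\Big(\frac{q(y|x)+p(y|x)}{q(y|x)}\Big)\big(q(y|x)+p(y|x)\big).$$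 3. $\mathcal L_0(\theta)=\prod_{i\in D_0}q_\theta(Y_i|X_i)$ for $\theta\in\Theta_0$, $\mathcal L_0(\hat\theta_1)=\prod_{i\in D_0}p(Y_i|X_i)$, and $\hat\theta_0\in\operatorname*{arg\,max}_{\theta\in\Theta_0}\mathcal L_0(\theta)$. 4. $T_n=\mathcal L_0(\hat\theta_1)/\mathcal L_0(\hat\theta_0)$. $T_n^{\rm swap}$ is computed in the same way with the roles of $D_0$ and $D_1$ exchanged. $S_n=(T_n+T_n^{\rm swap})/2$. **Conventions.** The objects in the construction are understood to be well defined: the estimators, the selection $p$ and the map $q_\theta$ are suitably measurable, a strictly positive $p(\cdot|x)$ exists, the $\arg\min$ is a uniquely determined minimizer, and the $\arg\max$ is attained. *)

theory Defs
  imports "HOL-Probability.Probability"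
begin

abbreviation borel_on :: "'a::topological_space set \<Rightarrow> 'a measure" where
  "borel_on S \<equiv> restrict_space borel S"

(* latent_law m \<theta> x is F_\<theta>(.|x), and corr m \<theta> u x is G(u|x;\<theta>). *)
record ('t, 'x, 'u, 'y) model =
  outcomes :: "'y set"
  covariates :: "'x set"
  latents :: "'u set"
  params :: "'t set"
  latent_law :: "'t \<Rightarrow> 'x \<Rightarrow> 'u measure"
  corr :: "'t \<Rightarrow> 'u \<Rightarrow> 'x \<Rightarrow> 'y set"

definition weakly_measurable :: "'w measure \<Rightarrow> ('w \<Rightarrow> 'y::topological_space set) \<Rightarrow> bool" where
  "weakly_measurable N \<Gamma> \<longleftrightarrow> (\<forall>V. open V \<longrightarrow> {w \<in> space N. \<Gamma> w \<inter> V \<noteq> {}} \<in> sets N)"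

definition incomplete_model ::
  "('t, 'x::euclidean_space, 'u::euclidean_space, 'y::euclidean_space) model \<Rightarrow> bool" where
  "incomplete_model m \<longleftrightarrow>
     finite (outcomes m) \<and>
     (\<forall>\<theta>\<in>params m.
        latent_law m \<theta> \<in> borel_on (covariates m) \<rightarrow>\<^sub>M prob_algebra (borel_on (latents m)) \<and>
        (\<forall>u\<in>latents m. \<forall>x\<in>covariates m. corr m \<theta> u x \<noteq> {} \<and> corr m \<theta> u x \<subseteq> outcomes m) \<and>
        weakly_measurable (borel_on (latents m) \<Otimes>\<^sub>M borel_on (covariates m))
          (\<lambda>(u, x). corr m \<theta> u x))"

definition containment :: "('t, 'x, 'u, 'y) model \<Rightarrow> 't \<Rightarrow> 'y set \<Rightarrow> 'x \<Rightarrow> real" where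
  "containment m \<theta> A x = (\<integral>u. indicator {u. corr m \<theta> u x \<subseteq> A} u \<partial>latent_law m \<theta> x)"

definition core :: "('t, 'x, 'u, 'y::euclidean_space) model \<Rightarrow> 't \<Rightarrow> 'x \<Rightarrow> 'y measure set" where
  "core m \<theta> x = {Q \<in> space (prob_algebra (borel_on (outcomes m))).
     \<forall>A. A \<subseteq> outcomes m \<longrightarrow> measure Q A \<ge> containment m \<theta> A x}"

(* Elements are total functions that vanish outside the outcome set, because measure Q {y} = 0
   there.  Uniqueness of a minimizer over this set is therefore uniqueness on the outcome set. *)
definition core_pmfs :: "('t, 'x, 'u, 'y::euclidean_space) model \<Rightarrow> 't \<Rightarrow> 'x \<Rightarrow> ('y \<Rightarrow> real) set" where
  "core_pmfs m \<theta> x = (\<lambda>Q y. measure Q {y}) ` core m \<theta> x"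

definition obs_space :: "('t, 'x::euclidean_space, 'u, 'y::euclidean_space) model \<Rightarrow> ('y \<times> 'x) measure" where
  "obs_space m = borel_on (outcomes m) \<Otimes>\<^sub>M borel_on (covariates m)"

definition sample_space ::
  "('t, 'x::euclidean_space, 'u, 'y::euclidean_space) model \<Rightarrow> nat set \<Rightarrow> (nat \<Rightarrow> 'y \<times> 'x) measure" where
  "sample_space m I = (\<Pi>\<^sub>M i\<in>I. obs_space m)"

(* K is a version of the regular conditional law of the outcome given the covariate under P. *)
definition is_cond_law ::
  "('t, 'x::euclidean_space, 'u, 'y::euclidean_space) model \<Rightarrow> ('y \<times> 'x) measure \<Rightarrow> ('x \<Rightarrow> 'y measure) \<Rightarrow> bool" where
  "is_cond_law m P K \<longleftrightarrow>
     K \<in> borel_on (covariates m) \<rightarrow>\<^sub>M prob_algebra (borel_on (outcomes m)) \<and>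
     (\<forall>A\<in>sets (borel_on (outcomes m)). \<forall>B\<in>sets (borel_on (covariates m)).
        emeasure P (A \<times> B) =
        (\<integral>\<^sup>+x\<in>B. emeasure (K x) A \<partial>distr P (borel_on (covariates m)) snd))"

definition dgps ::
  "('t, 'x::euclidean_space, 'u, 'y::euclidean_space) model \<Rightarrow> 't \<Rightarrow> nat \<Rightarrow> (nat \<Rightarrow> 'y \<times> 'x) measure set" where
  "dgps m \<theta> n = {P \<in> space (prob_algebra (sample_space m {1..n})).
     \<exists>Pi. P = (\<Pi>\<^sub>M i\<in>{1..n}. Pi i) \<and>
       (\<forall>i\<in>{1..n}. Pi i \<in> space (prob_algebra (obs_space m)) \<and>
          (\<exists>K. is_cond_law m (Pi i) K \<and> (\<forall>x\<in>covariates m. K x \<in> core m \<theta> x)))}"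

definition null_dgps ::
  "('t, 'x::euclidean_space, 'u, 'y::euclidean_space) model \<Rightarrow> 't set \<Rightarrow> nat \<Rightarrow> (nat \<Rightarrow> 'y \<times> 'x) measure set" where
  "null_dgps m \<Theta>\<^sub>0 n = (\<Union>\<theta>\<in>\<Theta>\<^sub>0. dgps m \<theta> n)"

definition full_space ::
  "('t, 'x::euclidean_space, 'u::euclidean_space, 'y::euclidean_space) model \<Rightarrow> ('y \<times> 'x \<times> 'u) measure" where
  "full_space m = borel_on (outcomes m) \<Otimes>\<^sub>M borel_on (covariates m) \<Otimes>\<^sub>M borel_on (latents m)"

definition full_laws ::
  "('t, 'x::euclidean_space, 'u::euclidean_space, 'y::euclidean_space) model \<Rightarrow> nat
    \<Rightarrow> (nat \<Rightarrow> 'y \<times> 'x \<times> 'u) measure set" where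
  "full_laws m n = space (prob_algebra (\<Pi>\<^sub>M i\<in>{1..n}. full_space m))"

definition observed_law ::
  "('t, 'x::euclidean_space, 'u, 'y::euclidean_space) model \<Rightarrow> nat
    \<Rightarrow> (nat \<Rightarrow> 'y \<times> 'x \<times> 'u) measure \<Rightarrow> (nat \<Rightarrow> 'y \<times> 'x) measure" where
  "observed_law m n Q =
     distr Q (sample_space m {1..n}) (\<lambda>w. \<lambda>i\<in>{1..n}. case w i of (y, x, u) \<Rightarrow> (y, x))"

definition independent_units ::
  "('t, 'x::euclidean_space, 'u::euclidean_space, 'y::euclidean_space) model \<Rightarrow> nat
    \<Rightarrow> (nat \<Rightarrow> 'y \<times> 'x \<times> 'u) measure \<Rightarrow> bool" where
  "independent_units m n Q \<longleftrightarrow>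
     prob_space.indep_vars Q (\<lambda>i. full_space m) (\<lambda>i w. w i) {1..n}"

definition identical_covariates_latents ::
  "('t, 'x::euclidean_space, 'u::euclidean_space, 'y::euclidean_space) model \<Rightarrow> nat
    \<Rightarrow> (nat \<Rightarrow> 'y \<times> 'x \<times> 'u) measure \<Rightarrow> bool" where
  "identical_covariates_latents m n Q \<longleftrightarrow>
     (\<forall>i\<in>{1..n}. \<forall>j\<in>{1..n}.
        distr Q (borel_on (covariates m) \<Otimes>\<^sub>M borel_on (latents m)) (\<lambda>w. snd (w i)) =
        distr Q (borel_on (covariates m) \<Otimes>\<^sub>M borel_on (latents m)) (\<lambda>w. snd (w j)))"

(* The objective is only used with p > 0, where a summand tends to infinity as q y tends to 0.
   The case distinction is needed since HOL would evaluate ln ((0 + p y) / 0) to 0. *)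
definition lfp_objective :: "'y set \<Rightarrow> ('y \<Rightarrow> real) \<Rightarrow> ('y \<Rightarrow> real) \<Rightarrow> ereal" where
  "lfp_objective Y p q =
     (\<Sum>y\<in>Y. if q y = 0 then \<infinity> else ereal (ln ((q y + p y) / q y) * (q y + p y)))"

definition is_unique_arg_min :: "('a \<Rightarrow> 'b::ord) \<Rightarrow> ('a \<Rightarrow> bool) \<Rightarrow> 'a \<Rightarrow> bool" where
  "is_unique_arg_min f P a \<longleftrightarrow> is_arg_min f P a \<and> (\<forall>b. is_arg_min f P b \<longrightarrow> b = a)"

(* One direction of the sample split.  The first three components take the data of the training
   part only; est_null takes the whole sample.
   est d: the unrestricted estimator;  num d x y: the density p(y|x);
   den d \<theta> x y: the LFP-based density q_\<theta>(y|x);  est_null w: the null-restricted estimator. *)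
record ('t, 'x, 'y) split_construction =
  est :: "(nat \<Rightarrow> 'y \<times> 'x) \<Rightarrow> 't"
  num :: "(nat \<Rightarrow> 'y \<times> 'x) \<Rightarrow> 'x \<Rightarrow> 'y \<Rightarrow> real"
  den :: "(nat \<Rightarrow> 'y \<times> 'x) \<Rightarrow> 't \<Rightarrow> 'x \<Rightarrow> 'y \<Rightarrow> real"
  est_null :: "(nat \<Rightarrow> 'y \<times> 'x) \<Rightarrow> 't"

definition likelihood :: "nat set \<Rightarrow> (nat \<Rightarrow> 'y \<times> 'x) \<Rightarrow> ('x \<Rightarrow> 'y \<Rightarrow> real) \<Rightarrow> real" where
  "likelihood D w q = (\<Prod>i\<in>D. q (snd (w i)) (fst (w i)))"

(* D0 is the evaluation part and D1 the training part.  The last three clauses are the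
   measurability requirements; no sigma-algebra on the parameter set is involved. *)
definition valid_construction ::
  "('t, 'x::euclidean_space, 'u, 'y::euclidean_space) model \<Rightarrow> 't set \<Rightarrow> nat set \<Rightarrow> nat set
    \<Rightarrow> ('t, 'x, 'y) split_construction \<Rightarrow> bool" where
  "valid_construction m \<Theta>\<^sub>0 D0 D1 c \<longleftrightarrow>
     (\<forall>d\<in>space (sample_space m D1).
        est c d \<in> params m \<and>
        (\<forall>x\<in>covariates m.
           num c d x \<in> core_pmfs m (est c d) x \<and>
           (\<forall>y\<in>outcomes m. num c d x y > 0) \<and>
           (\<forall>\<theta>\<in>\<Theta>\<^sub>0. is_unique_arg_min (lfp_objective (outcomes m) (num c d x))
                          (\<lambda>q. q \<in> core_pmfs m \<theta> x) (den c d \<theta> x)))) \<and>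
     (\<forall>w\<in>space (sample_space m (D0 \<union> D1)).
        is_arg_max (\<lambda>\<theta>. likelihood D0 w (den c (restrict w D1) \<theta>)) (\<lambda>\<theta>. \<theta> \<in> \<Theta>\<^sub>0) (est_null c w)) \<and>
     (\<forall>y\<in>outcomes m.
        (\<lambda>(d, x). num c d x y) \<in> borel_measurable (sample_space m D1 \<Otimes>\<^sub>M borel_on (covariates m))) \<and>
     (\<forall>\<theta>\<in>\<Theta>\<^sub>0. \<forall>y\<in>outcomes m.
        (\<lambda>(d, x). den c d \<theta> x y) \<in> borel_measurable (sample_space m D1 \<Otimes>\<^sub>M borel_on (covariates m))) \<and>
     (\<lambda>w. likelihood D0 w (den c (restrict w D1) (est_null c w)))
        \<in> borel_measurable (sample_space m (D0 \<union> D1))"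

(* The numerator is positive, so a vanishing denominator gives the value infinity in ennreal. *)
definition lr_stat ::
  "nat set \<Rightarrow> nat set \<Rightarrow> ('t, 'x, 'y) split_construction \<Rightarrow> (nat \<Rightarrow> 'y \<times> 'x) \<Rightarrow> ennreal" where
  "lr_stat D0 D1 c w =
     ennreal (likelihood D0 w (num c (restrict w D1))) /
     ennreal (likelihood D0 w (den c (restrict w D1) (est_null c w)))"

(* c trains on D1 and evaluates on D0; c' has the roles exchanged. *)
definition cross_fit_stat ::
  "nat set \<Rightarrow> nat set \<Rightarrow> ('t, 'x, 'y) split_construction \<Rightarrow> ('t, 'x, 'y) split_construction
    \<Rightarrow> (nat \<Rightarrow> 'y \<times> 'x) \<Rightarrow> ennreal" where
  "cross_fit_stat D0 D1 c c' w = (lr_stat D0 D1 c w + lr_stat D1 D0 c' w) / 2"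

end

theory Submission
  imports Defs
begin

text \<open>
  The heart of the proof is that the likelihood ratio \<open>p / q\<^sub>\<theta>\<close> has mean at most 1 under every element of
  the core, not only under \<open>q\<^sub>\<theta>\<close>.  Put \<open>r = p / q\<^sub>\<theta>\<close> and \<open>h r = r - ln (1 + r)\<close>.  The first-order
  condition at the minimizer says that \<open>q\<^sub>\<theta>\<close> maximizes the mean of \<open>h r\<close> over the core.  The law \<open>q'\<close> of
  the selection of \<open>G(u|x;\<theta>)\<close> that always takes the largest available \<open>r\<close> lies in the core and maximizes
  the mean of every increasing function of \<open>r\<close> simultaneously.  As \<open>h\<close> is strictly increasing and \<open>\<Y>\<close> is
  finite, \<open>C h r - r\<close> is increasing in \<open>r\<close> on \<open>\<Y>\<close> for large \<open>C\<close>; comparing its means under \<open>q\<^sub>\<theta>\<close> and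
  \<open>q'\<close> shows that \<open>q\<^sub>\<theta>\<close> maximizes the mean of \<open>r\<close> too, and that maximum is the total mass of \<open>p\<close>.

  Given the training part, \<open>T\<^sub>n\<close> is at most the product over the evaluation part of such ratios at the true
  \<open>\<theta>\<close>, so by independence its mean is at most 1, and Markov's inequality applies to \<open>S\<^sub>n\<close>.
\<close>

section \<open>Probability mass functions in the core\<close>

lemma sets_borel_on_finite:
  fixes Y :: "'a::t1_space set"
  assumes "finite Y"
  shows "sets (borel_on Y) = Pow Y"
proof -
  have "A \<in> sets (borel_on Y)" if "A \<subseteq> Y" for A
    using that finite_subset[OF that assms]
    by (auto simp: sets_restrict_space finite_imp_closed intro!: image_eqI[of _ _ A])
  then show ?thesis
    by (auto simp: sets_restrict_space)
qed

lemma containment_eq_measure: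
  "containment m \<theta> A x =
     measure (latent_law m \<theta> x) {u \<in> space (latent_law m \<theta> x). corr m \<theta> u x \<subseteq> A}"
  by (auto simp: containment_def intro!: arg_cong[where f = "measure _"])

text \<open>On a finite set a probability measure is the same as its vector of point masses, so the
  core becomes a set of vectors cut out by finitely many linear inequalities. Every later argument
  about the core uses this form. For the converse, \<open>point_measure\<close> rebuilds the measure
  from the vector.\<close>

lemma core_pmfs_iff:
  fixes m :: "('t, 'x, 'u, 'y::euclidean_space) model"
  assumes fin: "finite (outcomes m)"
  shows "q \<in> core_pmfs m \<theta> x \<longleftrightarrow>
    (\<forall>y. 0 \<le> q y) \<and> (\<forall>y. y \<notin> outcomes m \<longrightarrow> q y = 0) \<and> sum q (outcomes m) = 1 \<and>
    (\<forall>A. A \<subseteq> outcomes m \<longrightarrow> containment m \<theta> A x \<le> sum q A)" (is "_ \<longleftrightarrow> ?R")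
proof
  assume "q \<in> core_pmfs m \<theta> x"
  then obtain Q where Q: "Q \<in> space (prob_algebra (borel_on (outcomes m)))"
    and c: "\<And>A. A \<subseteq> outcomes m \<Longrightarrow> measure Q A \<ge> containment m \<theta> A x"
    and q: "q = (\<lambda>y. measure Q {y})"
    by (auto simp: core_pmfs_def core_def)
  interpret prob_space Q using Q by (simp add: space_prob_algebra)
  have s: "sets Q = Pow (outcomes m)"
    using Q by (simp add: space_prob_algebra sets_borel_on_finite[OF fin])
  have sp: "space Q = outcomes m" using sets_eq_imp_space_eq[of Q "count_space (outcomes m)"] s by simp
  have su: "sum q A = measure Q A" if "A \<subseteq> outcomes m" for A
    unfolding q using that finite_subset[OF that fin]
    by (subst finite_measure_eq_sum_singleton) (auto simp: s)
  have "q y = 0" if "y \<notin> outcomes m" for y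
    unfolding q using that s by (intro measure_notin_sets) auto
  then show ?R using su c prob_space by (auto simp: q sp)
next
  assume R: ?R
  define Q where "Q = point_measure (outcomes m) (\<lambda>y. ennreal (q y))"
  have e: "emeasure Q A = ennreal (sum q A)" if "A \<subseteq> outcomes m" for A
    unfolding Q_def using that finite_subset[OF that fin] R
    by (subst emeasure_point_measure_finite2) auto
  have "prob_space Q"
    by standard (use e[of "outcomes m"] R in \<open>simp add: Q_def space_point_measure\<close>)
  moreover have mq: "measure Q A = sum q A" if "A \<subseteq> outcomes m" for A
    using e[OF that] R by (simp add: measure_def sum_nonneg)
  ultimately have "Q \<in> core m \<theta> x"
    using R unfolding core_def
    by (auto simp: space_prob_algebra sets_borel_on_finite[OF fin] Q_def sets_point_measure)
  moreover have "q = (\<lambda>y. measure Q {y})"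
  proof
    fix y show "q y = measure Q {y}"
      using mq[of "{y}"] R by (cases "y \<in> outcomes m") (auto simp: Q_def sets_point_measure measure_notin_sets)
  qed
  ultimately show "q \<in> core_pmfs m \<theta> x" by (auto simp: core_pmfs_def)
qed

text \<open>Layer-cake argument: with \<open>l\<close> the minimum of \<phi>, the number \<phi> y -
  l is the length of the interval of t with l \<le> t < \<phi> y. Each shifted sum is therefore an
  integral over t of the weight of an upper level set, and the assumed inequality is integrated.
  Equal totals allow the shift to be undone.\<close>

lemma sum_mono_of_upper_level_sets:
  fixes a b \<phi> :: "'y \<Rightarrow> real"
  assumes fin: "finite Y" and tot: "sum a Y = sum b Y"
    and lev: "\<And>t. sum a {y \<in> Y. t < \<phi> y} \<le> sum b {y \<in> Y. t < \<phi> y}"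
  shows "(\<Sum>y\<in>Y. a y * \<phi> y) \<le> (\<Sum>y\<in>Y. b y * \<phi> y)"
proof (cases "Y = {}")
  case False
  \<comment> \<open>Starting the layers at the minimum keeps every interval bounded, which gives
    integrability.\<close>
  define l where "l = Min (\<phi> ` Y)"
  have l: "l \<le> \<phi> y" if "y \<in> Y" for y using that fin by (simp add: l_def)
  have layer: "(\<Sum>y\<in>Y. c y * (\<phi> y - l)) =
      (\<integral>t. indicator {l..} t * sum c {y \<in> Y. t < \<phi> y} \<partial>lborel)"
    and int: "integrable lborel (\<lambda>t. indicator {l..} t * sum c {y \<in> Y. t < \<phi> y})"
    for c :: "'y \<Rightarrow> real"
  proof -
    have eq: "indicator {l..} t * sum c {y \<in> Y. t < \<phi> y} = (\<Sum>y\<in>Y. c y * indicator {l..<\<phi> y} t)" for t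
      using fin by (auto simp: indicator_def sum_distrib_left sum.If_cases Int_def if_distrib
          intro!: sum.mono_neutral_cong_left)
    have i: "integrable lborel (\<lambda>t. c y * indicator {l..<\<phi> y} t)" if "y \<in> Y" for y
      by (auto intro!: integrable_real_indicator simp: emeasure_lborel_Ico[OF l[OF that]])
    show "integrable lborel (\<lambda>t. indicator {l..} t * sum c {y \<in> Y. t < \<phi> y})"
      unfolding eq using i by auto
    show "(\<Sum>y\<in>Y. c y * (\<phi> y - l)) =
      (\<integral>t. indicator {l..} t * sum c {y \<in> Y. t < \<phi> y} \<partial>lborel)"
      unfolding eq using i l by (subst Bochner_Integration.integral_sum) auto
  qed
  have "(\<Sum>y\<in>Y. a y * (\<phi> y - l)) \<le> (\<Sum>y\<in>Y. b y * (\<phi> y - l))"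
    unfolding layer by (intro integral_mono int mult_left_mono lev) auto
  then show ?thesis using tot
    by (simp add: right_diff_distrib sum_subtractf flip: sum_distrib_right)
qed simp

lemma core_pmfs_nonneg: "q \<in> core_pmfs m \<theta> x \<Longrightarrow> 0 \<le> q y"
  by (auto simp: core_pmfs_def)

text \<open>Weak measurability speaks only of hitting open sets. As the outcome set is finite, each
  single outcome can be isolated by an open set, and a value of the correspondence is determined by
  which of the finitely many outcomes it contains.\<close>

lemma corr_measurable:
  fixes m :: "('t, 'x::euclidean_space, 'u::euclidean_space, 'y::euclidean_space) model"
  assumes m: "incomplete_model m" and \<theta>: "\<theta> \<in> params m" and x: "x \<in> covariates m"
  shows "(\<lambda>u. corr m \<theta> u x) \<in> borel_on (latents m) \<rightarrow>\<^sub>M count_space (Pow (outcomes m))"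
proof -
  have fin: "finite (outcomes m)" using m by (simp add: incomplete_model_def)
  have sub: "corr m \<theta> u x \<subseteq> outcomes m" if "u \<in> latents m" for u
    using m \<theta> x that by (simp add: incomplete_model_def)
  have hit: "{u \<in> latents m. y \<in> corr m \<theta> u x} \<in> sets (borel_on (latents m))"
    if y: "y \<in> outcomes m" for y
  proof -
    \<comment> \<open>\<open>V\<close> is open as the complement of a finite set, and the only
      outcome in it is \<open>y\<close>. Hitting \<open>V\<close> therefore means containing
      \<open>y\<close>.\<close>
    define V where "V = - (outcomes m - {y})"
    have "open V" unfolding V_def using fin by (intro open_Compl finite_imp_closed finite_Diff)
    then have "{w \<in> space (borel_on (latents m) \<Otimes>\<^sub>M borel_on (covariates m)).
        (case w of (u, x) \<Rightarrow> corr m \<theta> u x) \<inter> V \<noteq> {}}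
      \<in> sets (borel_on (latents m) \<Otimes>\<^sub>M borel_on (covariates m))"
      using m \<theta> by (auto simp: incomplete_model_def weakly_measurable_def)
    from sets_Pair2[OF this, of x]
    have "{u \<in> latents m. corr m \<theta> u x \<inter> V \<noteq> {}} \<in> sets (borel_on (latents m))"
      by (rule back_subst[where P = "\<lambda>A. A \<in> _"]) (use x in \<open>auto simp: space_pair_measure space_restrict_space\<close>)
    moreover have "corr m \<theta> u x \<inter> V \<noteq> {} \<longleftrightarrow> y \<in> corr m \<theta> u x" if "u \<in> latents m" for u
      using sub[OF that] y by (auto simp: V_def)
    ultimately show ?thesis by (simp cong: conj_cong)
  qed
  have "(\<lambda>u. corr m \<theta> u x) -` {B} \<inter> space (borel_on (latents m)) \<in> sets (borel_on (latents m))"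
    if B: "B \<in> Pow (outcomes m)" for B
  proof -
    have "corr m \<theta> u x = B \<longleftrightarrow> (\<forall>y\<in>outcomes m. y \<in> corr m \<theta> u x \<longleftrightarrow> y \<in> B)"
      if "u \<in> latents m" for u
      using sub[OF that] B by blast
    then have eq: "(\<lambda>u. corr m \<theta> u x) -` {B} \<inter> space (borel_on (latents m)) =
      {u \<in> space (borel_on (latents m)). \<forall>y\<in>outcomes m. y \<in> corr m \<theta> u x \<longleftrightarrow> y \<in> B}"
      by (auto simp: space_restrict_space)
    have "{u \<in> space (borel_on (latents m)). y \<in> corr m \<theta> u x \<longleftrightarrow> y \<in> B} \<in> sets (borel_on (latents m))"
      if "y \<in> outcomes m" for y
      using hit[OF that] sets.sets_Collect_neg[of "borel_on (latents m)" "\<lambda>u. y \<in> corr m \<theta> u x"]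
      by (cases "y \<in> B") (simp_all add: space_restrict_space)
    then show ?thesis unfolding eq using fin by (intro sets.sets_Collect_finite_All)
  qed
  then show ?thesis
    using fin sub by (subst measurable_count_space_eq2) (auto simp: space_restrict_space)
qed

text \<open>The maximizing element is the law of a selection from the random set that always picks an
  outcome with the largest value of \<open>r\<close>.\<close>

lemma core_pmfs_greedy:
  fixes m :: "('t, 'x::euclidean_space, 'u::euclidean_space, 'y::euclidean_space) model"
    and r :: "'y \<Rightarrow> real"
  assumes m: "incomplete_model m" and \<theta>: "\<theta> \<in> params m" and x: "x \<in> covariates m"
  shows "\<exists>q'\<in>core_pmfs m \<theta> x. \<forall>q\<in>core_pmfs m \<theta> x. \<forall>\<phi> :: 'y \<Rightarrow> real.
    (\<forall>y\<in>outcomes m. \<forall>z\<in>outcomes m. r y \<le> r z \<longrightarrow> \<phi> y \<le> \<phi> z) \<longrightarrow>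
    (\<Sum>y\<in>outcomes m. q y * \<phi> y) \<le> (\<Sum>y\<in>outcomes m. q' y * \<phi> y)"
proof -
  define Y where "Y = outcomes m"
  define F where "F = latent_law m \<theta> x"
  define \<sigma> where "\<sigma> B = (SOME y. y \<in> B \<and> (\<forall>z\<in>B. r z \<le> r y))" for B
  define q' where "q' y = measure F {u \<in> space F. \<sigma> (corr m \<theta> u x) = y}" for y
  have fin: "finite Y" using m by (simp add: incomplete_model_def Y_def)
  have "latent_law m \<theta> \<in> borel_on (covariates m) \<rightarrow>\<^sub>M prob_algebra (borel_on (latents m))"
    using m \<theta> by (auto simp: incomplete_model_def)
  from measurable_space[OF this, of x] x
  have F: "prob_space F" "sets F = sets (borel_on (latents m))"
    by (auto simp: F_def space_prob_algebra space_restrict_space)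
  interpret prob_space F by fact
  have spF: "space F = latents m"
    using sets_eq_imp_space_eq[OF F(2)] by (simp add: space_restrict_space)
  have G: "corr m \<theta> u x \<noteq> {}" "corr m \<theta> u x \<subseteq> Y" if "u \<in> space F" for u
    using m \<theta> x that spF by (auto simp: incomplete_model_def Y_def)
  have Gm: "(\<lambda>u. corr m \<theta> u x) \<in> F \<rightarrow>\<^sub>M count_space (Pow Y)"
    using corr_measurable[OF m \<theta> x] by (simp add: Y_def measurable_cong_sets[OF F(2) refl])
  \<comment> \<open>The random set takes values in a finite power set with the discrete
    sigma-algebra, so every predicate of it defines an event.\<close>
  have ev: "{u \<in> space F. P (corr m \<theta> u x)} \<in> events" for P
  proof -
    have "{u \<in> space F. P (corr m \<theta> u x)} = (\<lambda>u. corr m \<theta> u x) -` {B \<in> Pow Y. P B} \<inter> space F"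
      using G by auto
    then show ?thesis by (simp only:) (rule measurable_sets[OF Gm], auto)
  qed
  have \<sigma>: "\<sigma> B \<in> B" "\<And>y. y \<in> B \<Longrightarrow> r y \<le> r (\<sigma> B)" if "B \<noteq> {}" "B \<subseteq> Y" for B
  proof -
    have "finite B" using that fin finite_subset by blast
    then have "Max (r ` B) \<in> r ` B" using that by simp
    then obtain y where "y \<in> B" "r y = Max (r ` B)" by auto
    then have "\<exists>y. y \<in> B \<and> (\<forall>z\<in>B. r z \<le> r y)" using \<open>finite B\<close> by auto
    from someI_ex[OF this] show "\<sigma> B \<in> B" "\<And>y. y \<in> B \<Longrightarrow> r y \<le> r (\<sigma> B)"
      by (auto simp: \<sigma>_def)
  qed
  have \<sigma>_in: "\<sigma> (corr m \<theta> u x) \<in> corr m \<theta> u x" "\<sigma> (corr m \<theta> u x) \<in> Y"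
    if "u \<in> space F" for u
    using \<sigma>(1)[OF G[OF that]] G(2)[OF that] by auto
  have sum_q': "sum q' A = prob {u \<in> space F. \<sigma> (corr m \<theta> u x) \<in> A}" if "A \<subseteq> Y" for A
  proof -
    have "prob (\<Union>y\<in>A. {u \<in> space F. \<sigma> (corr m \<theta> u x) = y}) = sum q' A"
      unfolding q'_def using finite_subset[OF that fin]
      by (intro finite_measure_finite_Union) (auto intro: ev simp: disjoint_family_on_def)
    then show ?thesis by (rule back_subst[where P = "\<lambda>B. _ = prob B", OF sym]) auto
  qed
  have tot: "sum q' Y = 1"
  proof -
    have "{u \<in> space F. \<sigma> (corr m \<theta> u x) \<in> Y} = space F" using \<sigma>_in by blast
    then show ?thesis by (simp add: sum_q' prob_space)
  qed
  have "q' \<in> core_pmfs m \<theta> x"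
    unfolding core_pmfs_iff[OF fin[unfolded Y_def]]
  proof (intro conjI allI impI)
    fix y assume "y \<notin> outcomes m"
    then have "{u \<in> space F. \<sigma> (corr m \<theta> u x) = y} = {}" using \<sigma>_in(2) by (auto simp: Y_def)
    then show "q' y = 0" unfolding q'_def by (simp only: measure_empty)
  next
    fix A assume "A \<subseteq> outcomes m"
    then show "containment m \<theta> A x \<le> sum q' A"
      unfolding containment_eq_measure F_def[symmetric]
      using \<sigma>_in(1) by (subst sum_q') (auto intro!: finite_measure_mono ev simp: Y_def)
  qed (use tot in \<open>auto simp: q'_def Y_def\<close>)
  moreover have "(\<Sum>y\<in>Y. q y * \<phi> y) \<le> (\<Sum>y\<in>Y. q' y * \<phi> y)"
    if q: "q \<in> core_pmfs m \<theta> x"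
      and \<phi>: "\<And>y z. y \<in> Y \<Longrightarrow> z \<in> Y \<Longrightarrow> r y \<le> r z \<Longrightarrow> \<phi> y \<le> \<phi> z"
    for q and \<phi> :: "'y \<Rightarrow> real"
  proof (rule sum_mono_of_upper_level_sets[OF fin])
    have q1: "sum q Y = 1" and qc: "\<And>A. A \<subseteq> Y \<Longrightarrow> containment m \<theta> A x \<le> sum q A"
      using q unfolding core_pmfs_iff[OF fin[unfolded Y_def]] by (auto simp: Y_def)
    show "sum q Y = sum q' Y" using q1 tot by simp
    fix t
    define L where "L = {y \<in> Y. t < \<phi> y}"
    have L: "L \<subseteq> Y" by (auto simp: L_def)
    \<comment> \<open>As \<phi> increases with \<open>r\<close>, the selection lies in the upper
      level set \<open>L\<close> whenever the random set meets \<open>L\<close> at all. Hence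
      \<open>q'\<close> gives \<open>L\<close> the mass 1 - \<nu>(Y - L), and the core inequality
      for Y - L says that no core element gives it more.\<close>
    have "\<sigma> (corr m \<theta> u x) \<in> L \<longleftrightarrow> \<not> corr m \<theta> u x \<subseteq> Y - L" if u: "u \<in> space F" for u
    proof
      assume "\<not> corr m \<theta> u x \<subseteq> Y - L"
      then obtain y where y: "y \<in> corr m \<theta> u x" "y \<in> L" using G(2)[OF u] by auto
      then have "\<phi> y \<le> \<phi> (\<sigma> (corr m \<theta> u x))"
        using \<sigma>(2)[OF G[OF u] y(1)] \<sigma>_in(2)[OF u] L by (intro \<phi>) auto
      then show "\<sigma> (corr m \<theta> u x) \<in> L"
        using y(2) \<sigma>_in(2)[OF u] by (auto simp: L_def)
    qed (use \<sigma>_in(1)[OF u] in auto)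
    then have "sum q' L = prob (space F - {u \<in> space F. corr m \<theta> u x \<subseteq> Y - L})"
      unfolding sum_q'[OF L] by (intro arg_cong[where f = prob]) auto
    also have "\<dots> = 1 - containment m \<theta> (Y - L) x"
      by (subst prob_compl[OF ev]) (simp add: containment_eq_measure F_def)
    also have "\<dots> \<ge> 1 - sum q (Y - L)" using qc[of "Y - L"] by auto
    also have "1 - sum q (Y - L) = sum q L"
      using q1 sum.subset_diff[OF L fin, of q] by simp
    finally show "sum q {y \<in> Y. t < \<phi> y} \<le> sum q' {y \<in> Y. t < \<phi> y}" by (simp add: L_def)
  qed
  ultimately show ?thesis unfolding Y_def by blast
qed

lemma core_pmfs_convex:
  fixes m :: "('t, 'x, 'u, 'y::euclidean_space) model"
  assumes fin: "finite (outcomes m)" and q: "q \<in> core_pmfs m \<theta> x" "q' \<in> core_pmfs m \<theta> x"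
    and s: "0 \<le> s" "s \<le> 1"
  shows "(\<lambda>y. (1 - s) * q y + s * q' y) \<in> core_pmfs m \<theta> x"
proof -
  have "containment m \<theta> A x \<le> (\<Sum>y\<in>A. (1 - s) * q y + s * q' y)" if "A \<subseteq> outcomes m" for A
  proof -
    have "containment m \<theta> A x = (1 - s) * containment m \<theta> A x + s * containment m \<theta> A x"
      by (simp add: algebra_simps)
    also have "\<dots> \<le> (1 - s) * sum q A + s * sum q' A"
      using q s that unfolding core_pmfs_iff[OF fin] by (intro add_mono mult_left_mono) auto
    finally show ?thesis by (simp add: sum.distrib sum_distrib_left)
  qed
  then show ?thesis
    using q s unfolding core_pmfs_iff[OF fin]
    by (auto simp: sum.distrib simp flip: sum_distrib_left)
qed


section \<open>The least favorable density\<close>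

text \<open>The right derivative of the objective at 0 along the segment from \<open>q\<close> to
  \<open>q'\<close> cannot be negative. The summand ln ((q + p) / q) * (q + p) has derivative ln (1
  + p / q) - p / q in q, which is minus the function averaged here.\<close>

lemma lfp_objective_first_order:
  fixes p q q' :: "'y \<Rightarrow> real"
  assumes p: "\<And>y. y \<in> Y \<Longrightarrow> 0 < p y" and q: "\<And>y. y \<in> Y \<Longrightarrow> 0 < q y"
    and q': "\<And>y. y \<in> Y \<Longrightarrow> 0 \<le> q' y"
    and min: "\<And>s. 0 < s \<Longrightarrow> s < 1 \<Longrightarrow>
      lfp_objective Y p q \<le> lfp_objective Y p (\<lambda>y. (1 - s) * q y + s * q' y)"
  shows "(\<Sum>y\<in>Y. q' y * (p y / q y - ln (1 + p y / q y)))
    \<le> (\<Sum>y\<in>Y. q y * (p y / q y - ln (1 + p y / q y)))"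
proof -
  define Q where "Q s y = (1 - s) * q y + s * q' y" for s y
  define f where "f s = (\<Sum>y\<in>Y. ln ((Q s y + p y) / Q s y) * (Q s y + p y))" for s
  \<comment> \<open>The endpoint s = 1 is left out because \<open>q'\<close> may vanish somewhere;
    before it the objective is finite and equals the smooth function \<open>f\<close>.\<close>
  have Q_pos: "0 < Q s y" if "y \<in> Y" "0 \<le> s" "s < 1" for s y
    using that q q' unfolding Q_def by (intro add_pos_nonneg) auto
  have obj: "lfp_objective Y p (Q s) = ereal (f s)" if "0 \<le> s" "s < 1" for s
  proof -
    have "lfp_objective Y p (Q s) =
        (\<Sum>y\<in>Y. ereal (ln ((Q s y + p y) / Q s y) * (Q s y + p y)))"
      unfolding lfp_objective_def using Q_pos[OF _ that] by (intro sum.cong) (auto simp: less_le)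
    then show ?thesis by (simp add: f_def)
  qed
  have "((\<lambda>s. ln ((Q s y + p y) / Q s y) * (Q s y + p y)) has_real_derivative
      (q' y - q y) * (ln (1 + p y / q y) - p y / q y)) (at 0)" if y: "y \<in> Y" for y
  proof -
    have pos: "0 < q y" "0 < p y" using p q y by auto
    have Q0: "Q 0 y = q y" by (simp add: Q_def)
    have Q': "((\<lambda>s. Q s y) has_real_derivative (q' y - q y)) (at 0)"
      unfolding Q_def by (auto intro!: derivative_eq_intros)
    have ln: "ln ((q y + p y) / q y) = ln (1 + p y / q y)"
      using pos by (simp add: add_divide_distrib)
    have *: "((\<lambda>s. (Q s y + p y) / Q s y) has_real_derivative
        (((q' y - q y) * q y - (q y + p y) * (q' y - q y)) / (q y * q y))) (at 0)"
      using pos by (auto intro!: derivative_eq_intros Q' simp: Q0)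
    have "((\<lambda>s. ln ((Q s y + p y) / Q s y) * (Q s y + p y)) has_real_derivative
        ((((q' y - q y) * q y - (q y + p y) * (q' y - q y)) / (q y * q y)) / ((q y + p y) / q y)
          * (q y + p y) + (q' y - q y) * ln ((q y + p y) / q y))) (at 0)"
      using pos by (auto intro!: derivative_eq_intros * Q' simp: Q0)
    also have "(((q' y - q y) * q y - (q y + p y) * (q' y - q y)) / (q y * q y)) / ((q y + p y) / q y)
          * (q y + p y) = - (q' y - q y) * (p y / q y)"
      using pos by (simp add: divide_simps) (simp add: algebra_simps)
    finally show ?thesis by (rule DERIV_cong) (unfold ln, simp add: algebra_simps diff_divide_distrib)
  qed
  then have deriv: "(f has_real_derivative
      (\<Sum>y\<in>Y. (q' y - q y) * (ln (1 + p y / q y) - p y / q y))) (at 0)"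
    unfolding f_def by (intro DERIV_sum)
  have "0 \<le> (\<Sum>y\<in>Y. (q' y - q y) * (ln (1 + p y / q y) - p y / q y))"
  proof (rule ccontr)
    assume "\<not> ?thesis"
    then obtain d where d: "d > 0" "\<And>h. 0 < h \<Longrightarrow> h < d \<Longrightarrow> f (0 + h) < f 0"
      using DERIV_neg_dec_right[OF deriv] by auto
    \<comment> \<open>This point lies both in the range where \<open>f\<close> is below
      \<open>f 0\<close> and in the range where minimality is assumed.\<close>
    define s where "s = min (d / 2) (1 / 2)"
    have s: "0 < s" "s < d" "s < 1" using d(1) by (auto simp: s_def min_def)
    have "lfp_objective Y p (Q 0) \<le> lfp_objective Y p (Q s)"
      using min[OF s(1,3)] by (simp add: Q_def[abs_def])
    then show False using d(2)[OF s(1,2)] s by (simp add: obj)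
  qed
  also have "\<dots> = (\<Sum>y\<in>Y. q y * (p y / q y - ln (1 + p y / q y)) -
      q' y * (p y / q y - ln (1 + p y / q y)))"
    by (intro sum.cong refl) (simp only: left_diff_distrib right_diff_distrib; simp)
  finally show ?thesis by (simp only: sum_subtractf diff_ge_0_iff_ge)
qed

text \<open>Factor 1 + b = (1 + a) (1 + d). The logarithm then grows by ln (1 + d) < d, and d \<le>
  b - a because 1 + a > 1.\<close>

lemma ln_add_one_gap_strict_mono:
  fixes a b :: real
  assumes "0 < a" "a < b"
  shows "a - ln (1 + a) < b - ln (1 + b)"
proof -
  define d where "d = (b - a) / (1 + a)"
  have d: "0 < d" "(1 + b) = (1 + a) * (1 + d)"
    using assms by (auto simp: d_def field_simps)
  have "d \<le> b - a" using assms by (simp add: d_def field_simps)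
  moreover have "ln (1 + d) < d" by (rule ln_add_one_self_less_self[OF d(1)])
  moreover have "ln (1 + b) = ln (1 + a) + ln (1 + d)"
    unfolding d(2) using assms d(1) by (intro ln_mult_pos) auto
  ultimately show ?thesis by simp
qed

lemma lfp_ratio_bound:
  fixes m :: "('t, 'x::euclidean_space, 'u::euclidean_space, 'y::euclidean_space) model"
  assumes m: "incomplete_model m" and \<theta>: "\<theta> \<in> params m" and x: "x \<in> covariates m"
    and p: "\<And>y. y \<in> outcomes m \<Longrightarrow> 0 < p y" and p1: "sum p (outcomes m) = 1"
    and min: "is_unique_arg_min (lfp_objective (outcomes m) p) (\<lambda>q. q \<in> core_pmfs m \<theta> x) qs"
    and q: "q \<in> core_pmfs m \<theta> x"
  shows "(\<Sum>y\<in>outcomes m. ennreal (q y) * (ennreal (p y) / ennreal (qs y))) \<le> 1"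
proof -
  define Y where "Y = outcomes m"
  have fin: "finite Y" using m by (simp add: incomplete_model_def Y_def)
  have qs: "qs \<in> core_pmfs m \<theta> x"
    and qs_min: "\<And>q. q \<in> core_pmfs m \<theta> x \<Longrightarrow> lfp_objective Y p qs \<le> lfp_objective Y p q"
    using min by (auto simp: is_unique_arg_min_def is_arg_min_def Y_def not_less)
  show ?thesis
  proof (cases "\<forall>y\<in>Y. 0 < qs y")
    case True
    define r where "r y = p y / qs y" for y
    define h where "h y = r y - ln (1 + r y)" for y
    have r_pos: "0 < r y" if "y \<in> Y" for y using True p that by (simp add: r_def Y_def)
    obtain q' where q': "q' \<in> core_pmfs m \<theta> x"
      and dom: "\<forall>q\<in>core_pmfs m \<theta> x. \<forall>\<phi> :: 'y \<Rightarrow> real.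
        (\<forall>y\<in>Y. \<forall>z\<in>Y. r y \<le> r z \<longrightarrow> \<phi> y \<le> \<phi> z) \<longrightarrow>
        (\<Sum>y\<in>Y. q y * \<phi> y) \<le> (\<Sum>y\<in>Y. q' y * \<phi> y)"
      using core_pmfs_greedy[OF m \<theta> x, of r] unfolding Y_def by (elim bexE)
    have foc: "(\<Sum>y\<in>Y. q' y * h y) \<le> (\<Sum>y\<in>Y. qs y * h y)"
      unfolding h_def r_def
      using True p core_pmfs_nonneg[OF q'] fin
      by (intro lfp_objective_first_order qs_min core_pmfs_convex) (auto simp: Y_def qs q')
    \<comment> \<open>The largest slope of \<open>r\<close> against \<open>h\<close> over pairs of
      outcomes. Inserting 0 makes \<open>C\<close> nonnegative; pairs with equal \<open>h\<close>
      contribute 0 by the convention for division by zero.\<close>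
    define C where "C = Max (insert 0 ((\<lambda>(y, z). (r z - r y) / (h z - h y)) ` (Y \<times> Y)))"
    have C: "0 \<le> C" "\<And>y z. y \<in> Y \<Longrightarrow> z \<in> Y \<Longrightarrow> (r z - r y) / (h z - h y) \<le> C"
      using fin by (auto simp: C_def intro!: Max_ge)
    have mono: "C * h y - r y \<le> C * h z - r z" if yz: "y \<in> Y" "z \<in> Y" "r y \<le> r z" for y z
    proof (cases "r y = r z")
      case False
      then have "h y < h z"
        using ln_add_one_gap_strict_mono[of "r y" "r z"] r_pos yz by (simp add: h_def)
      then show ?thesis using C(2)[OF yz(1,2)] by (simp add: field_simps)
    qed (simp add: h_def)
    \<comment> \<open>Dominance of \<open>q'\<close> for \<open>C * h - r\<close>, combined with the
      opposite inequality \<open>foc\<close> for \<open>h\<close>, forces the mean of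
      \<open>r\<close> under \<open>q'\<close> to be at most that under \<open>qs\<close>. Dominance
      for \<open>r\<close> itself then covers every \<open>q\<close> in the core.\<close>
    have "(\<Sum>y\<in>Y. qs y * (C * h y - r y)) \<le> (\<Sum>y\<in>Y. q' y * (C * h y - r y))"
      using dom[rule_format, OF qs, of "\<lambda>y. C * h y - r y"] mono by simp
    then have "(\<Sum>y\<in>Y. q' y * r y) - (\<Sum>y\<in>Y. qs y * r y)
        \<le> C * ((\<Sum>y\<in>Y. q' y * h y) - (\<Sum>y\<in>Y. qs y * h y))"
      by (simp add: algebra_simps sum_subtractf sum_distrib_left)
    also have "\<dots> \<le> 0" using C(1) foc by (simp add: mult_nonneg_nonpos)
    finally have "(\<Sum>y\<in>Y. q' y * r y) \<le> (\<Sum>y\<in>Y. qs y * r y)" by simp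
    also have "\<dots> = sum p Y" using True by (intro sum.cong) (auto simp: r_def)
    finally have "(\<Sum>y\<in>Y. q y * r y) \<le> 1"
      using dom[rule_format, OF q, of r] p1 by (simp add: Y_def)
    moreover have "(\<Sum>y\<in>Y. ennreal (q y) * (ennreal (p y) / ennreal (qs y)))
        = (\<Sum>y\<in>Y. ennreal (q y * r y))"
      using True p core_pmfs_nonneg[OF q] r_pos
      by (intro sum.cong)
        (auto simp: r_def Y_def divide_ennreal less_imp_le simp flip: ennreal_mult)
    ultimately show ?thesis
      using core_pmfs_nonneg[OF q] r_pos by (simp add: Y_def[symmetric] less_imp_le)
  next
    case False
    \<comment> \<open>All elements of the core then have objective \<open>\<infinity>\<close>, so uniqueness makes the core a singleton.\<close>
    then obtain y0 where "y0 \<in> Y" "qs y0 = 0" using core_pmfs_nonneg[OF qs] by (metis less_le)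
    then have "lfp_objective Y p qs = \<infinity>"
      using fin by (auto simp: lfp_objective_def sum_Pinfty)
    then have "lfp_objective Y p q' = \<infinity>" if "q' \<in> core_pmfs m \<theta> x" for q'
      using qs_min[OF that] by simp
    then have "is_arg_min (lfp_objective Y p) (\<lambda>q. q \<in> core_pmfs m \<theta> x) q"
      using q by (auto simp: is_arg_min_def)
    then have "q = qs" using min by (auto simp: is_unique_arg_min_def Y_def)
    have "(\<Sum>y\<in>Y. ennreal (q y) * (ennreal (p y) / ennreal (qs y))) \<le> (\<Sum>y\<in>Y. ennreal (p y))"
    proof (intro sum_mono)
      fix y assume "y \<in> Y"
      show "ennreal (q y) * (ennreal (p y) / ennreal (qs y)) \<le> ennreal (p y)"
      \<comment> \<open>Where \<open>qs\<close> vanishes the ratio is infinite, but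
        \<open>q = qs\<close> has no mass there and 0 times infinity is 0 in
        \<open>ennreal\<close>.\<close>
      proof (cases "qs y = 0")
        case False
        then have "0 < qs y" using core_pmfs_nonneg[OF qs, of y] by simp
        then show ?thesis using p[of y] \<open>y \<in> Y\<close>
          by (simp add: \<open>q = qs\<close> Y_def divide_ennreal less_imp_le flip: ennreal_mult)
      qed (simp add: \<open>q = qs\<close>)
    qed
    also have "\<dots> = 1" using p p1 by (simp add: Y_def less_imp_le)
    finally show ?thesis by (simp add: Y_def)
  qed
qed


section \<open>Expectation of the likelihood ratio\<close>

text \<open>The construction is assumed measurable for each outcome separately. Finitely many
  outcomes allow these pieces to be glued into joint measurability in the observation.\<close>

lemma measurable_obs_cases:
  fixes m :: "('t, 'x::euclidean_space, 'u, 'y::euclidean_space) model"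
  assumes fin: "finite (outcomes m)"
    and h: "\<And>y. y \<in> outcomes m \<Longrightarrow> (\<lambda>(d, x). h y d x) \<in> borel_measurable (N \<Otimes>\<^sub>M borel_on (covariates m))"
  shows "(\<lambda>(d, z). h (fst z) d (snd z)) \<in> borel_measurable (N \<Otimes>\<^sub>M obs_space m)"
proof -
  have "sets (borel_on (outcomes m)) = sets (count_space (outcomes m))"
    by (simp add: sets_borel_on_finite[OF fin])
  then have "(\<lambda>w. fst (snd w)) \<in> N \<Otimes>\<^sub>M obs_space m \<rightarrow>\<^sub>M count_space (outcomes m)"
    unfolding obs_space_def by (subst measurable_cong_sets[OF refl, symmetric]) measurable
  moreover have "(\<lambda>w. h y (fst w) (snd (snd w))) \<in> borel_measurable (N \<Otimes>\<^sub>M obs_space m)"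
    if "y \<in> outcomes m" for y
  proof -
    have "(\<lambda>w. (fst w, snd (snd w))) \<in> N \<Otimes>\<^sub>M obs_space m \<rightarrow>\<^sub>M N \<Otimes>\<^sub>M borel_on (covariates m)"
      unfolding obs_space_def by measurable
    from measurable_compose[OF this h[OF that]] show ?thesis by simp
  qed
  ultimately show ?thesis
    using fin by (subst case_prod_unfold)
      (rule measurable_compose_countable'[where f = "\<lambda>y w. h y (fst w) (snd (snd w))"
          and g = "\<lambda>w. fst (snd w)"], auto intro: countable_finite)
qed

text \<open>\<open>is_cond_law\<close> only fixes \<open>P\<close> on rectangles. On a slice with
  outcome \<open>y\<close>, this identifies the image of \<open>P\<close> on the covariates with the
  measure of density \<open>emeasure (K x) {y}\<close>; integrating \<open>h y\<close> against both
  and summing over the slices gives the formula.\<close>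

lemma nn_integral_cond_law:
  fixes m :: "('t, 'x::euclidean_space, 'u, 'y::euclidean_space) model"
  assumes fin: "finite (outcomes m)" and P: "P \<in> space (prob_algebra (obs_space m))"
    and K: "is_cond_law m P K"
    and h: "\<And>y. y \<in> outcomes m \<Longrightarrow> h y \<in> borel_measurable (borel_on (covariates m))"
  shows "(\<integral>\<^sup>+z. h (fst z) (snd z) \<partial>P) =
    (\<integral>\<^sup>+x. (\<Sum>y\<in>outcomes m. emeasure (K x) {y} * h y x) \<partial>distr P (borel_on (covariates m)) snd)"
proof -
  define Y X where "Y = outcomes m" and "X = borel_on (covariates m)"
  have sP: "sets P = sets (borel_on Y \<Otimes>\<^sub>M X)"
    using P by (simp add: space_prob_algebra obs_space_def Y_def X_def)
  have spP: "space P = Y \<times> space X"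
    using sets_eq_imp_space_eq[OF sP] by (simp add: space_pair_measure space_restrict_space)
  have snd [measurable]: "snd \<in> P \<rightarrow>\<^sub>M X" by (simp cong: measurable_cong_sets add: sP)
  have slice: "{y} \<times> B \<in> sets P" if "y \<in> Y" "B \<in> sets X" for y B
    unfolding sP using that fin by (intro pair_measureI) (auto simp: sets_borel_on_finite Y_def)
  have ind [measurable]: "indicator ({y} \<times> space X) \<in> borel_measurable P" if "y \<in> Y" for y
    using slice[OF that] by auto
  have Km: "(\<lambda>x. emeasure (K x) {y}) \<in> borel_measurable X" if "y \<in> Y" for y
  proof -
    have "K \<in> X \<rightarrow>\<^sub>M subprob_algebra (borel_on Y)"
      using K measurable_prob_algebraD by (auto simp: is_cond_law_def X_def Y_def)
    then show ?thesis
      using that fin by (auto intro!: measurable_emeasure_kernel simp: sets_borel_on_finite Y_def)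
  qed
  have law: "distr (density P (indicator ({y} \<times> space X))) X snd =
      density (distr P X snd) (\<lambda>x. emeasure (K x) {y})" (is "?L = ?R") if y: "y \<in> Y" for y
  proof (rule measure_eqI)
    fix B assume "B \<in> sets ?L"
    then have B: "B \<in> sets X" by simp
    have "emeasure ?L B = (\<integral>\<^sup>+z. indicator ({y} \<times> space X) z * indicator (snd -` B \<inter> space P) z \<partial>P)"
      using B by (simp add: emeasure_distr
          emeasure_density[OF ind[OF y] measurable_sets[OF snd B]])
    also have "\<dots> = (\<integral>\<^sup>+z. indicator ({y} \<times> B) z \<partial>P)"
      using sets.sets_into_space[OF B] y
      by (intro nn_integral_cong) (auto simp: indicator_def spP)
    also have "\<dots> = emeasure P ({y} \<times> B)" using slice[OF y B] by simp
    also have "\<dots> = (\<integral>\<^sup>+x\<in>B. emeasure (K x) {y} \<partial>distr P X snd)"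
      using K B y fin by (auto simp: is_cond_law_def sets_borel_on_finite Y_def X_def)
    also have "\<dots> = emeasure ?R B"
      using B Km[OF y] by (subst emeasure_density) auto
    finally show "emeasure ?L B = emeasure ?R B" .
  qed simp
  have eq: "(\<integral>\<^sup>+z. indicator ({y} \<times> space X) z * h y (snd z) \<partial>P) =
      (\<integral>\<^sup>+x. emeasure (K x) {y} * h y x \<partial>distr P X snd)" if y: "y \<in> Y" for y
  proof -
    have [measurable]: "h y \<in> borel_measurable X" using h y by (simp add: X_def Y_def)
    note ind[OF y, measurable] Km[OF y, measurable]
    have "(\<integral>\<^sup>+z. indicator ({y} \<times> space X) z * h y (snd z) \<partial>P) =
        (\<integral>\<^sup>+x. h y x \<partial>distr (density P (indicator ({y} \<times> space X))) X snd)"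
      by (subst nn_integral_distr) (auto simp: nn_integral_density)
    also have "\<dots> = (\<integral>\<^sup>+x. h y x \<partial>density (distr P X snd) (\<lambda>x. emeasure (K x) {y}))"
      using law[OF y] by simp
    also have "\<dots> = (\<integral>\<^sup>+x. emeasure (K x) {y} * h y x \<partial>distr P X snd)"
      by (subst nn_integral_density) auto
    finally show ?thesis .
  qed
  have "(\<integral>\<^sup>+z. h (fst z) (snd z) \<partial>P) = (\<integral>\<^sup>+z. (\<Sum>y\<in>Y. indicator ({y} \<times> space X) z * h y (snd z)) \<partial>P)"
  proof (intro nn_integral_cong)
    fix z assume "z \<in> space P"
    then have "fst z \<in> Y" "snd z \<in> space X" by (auto simp: spP)
    then show "h (fst z) (snd z) = (\<Sum>y\<in>Y. indicator ({y} \<times> space X) z * h y (snd z))"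
      using fin by (subst sum.remove[of _ "fst z"])
        (auto simp: indicator_def Y_def mem_Times_iff intro!: sum.neutral)
  qed
  also have "\<dots> = (\<Sum>y\<in>Y. \<integral>\<^sup>+z. indicator ({y} \<times> space X) z * h y (snd z) \<partial>P)"
    using h by (intro nn_integral_sum borel_measurable_times_ennreal ind measurable_compose[OF snd])
      (auto simp: X_def Y_def)
  also have "\<dots> = (\<Sum>y\<in>Y. \<integral>\<^sup>+x. emeasure (K x) {y} * h y x \<partial>distr P X snd)"
    using eq by simp
  also have "\<dots> = (\<integral>\<^sup>+x. (\<Sum>y\<in>Y. emeasure (K x) {y} * h y x) \<partial>distr P X snd)"
    using h Km by (intro nn_integral_sum[symmetric] borel_measurable_times_ennreal)
      (auto simp: X_def Y_def)
  finally show ?thesis by (simp add: X_def Y_def)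
qed


text \<open>An ennreal factor is \<open>\<infinity>\<close> where the density at \<open>\<theta>\<close> vanishes; the outcome law puts no mass there,
  so such factors do not contribute to the mean.\<close>

definition lr_at ::
  "nat set \<Rightarrow> nat set \<Rightarrow> ('t, 'x, 'y) split_construction \<Rightarrow> 't \<Rightarrow> (nat \<Rightarrow> 'y \<times> 'x) \<Rightarrow> ennreal" where
  "lr_at D0 D1 c \<theta> w =
    (\<Prod>i\<in>D0. ennreal (num c (restrict w D1) (snd (w i)) (fst (w i))) /
             ennreal (den c (restrict w D1) \<theta> (snd (w i)) (fst (w i))))"

lemma valid_constructionD:
  assumes "valid_construction m \<Theta>\<^sub>0 D0 D1 c" and "d \<in> space (sample_space m D1)"
    and "x \<in> covariates m"
  shows "num c d x \<in> core_pmfs m (est c d) x"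
    and "\<And>y. y \<in> outcomes m \<Longrightarrow> 0 < num c d x y"
    and "\<And>\<theta>. \<theta> \<in> \<Theta>\<^sub>0 \<Longrightarrow> is_unique_arg_min (lfp_objective (outcomes m) (num c d x))
      (\<lambda>q. q \<in> core_pmfs m \<theta> x) (den c d \<theta> x)"
    and "\<And>\<theta> y. \<theta> \<in> \<Theta>\<^sub>0 \<Longrightarrow> 0 \<le> den c d \<theta> x y"
proof -
  show "is_unique_arg_min (lfp_objective (outcomes m) (num c d x))
      (\<lambda>q. q \<in> core_pmfs m \<theta> x) (den c d \<theta> x)" if "\<theta> \<in> \<Theta>\<^sub>0" for \<theta>
    using assms that by (simp add: valid_construction_def)
  then show "0 \<le> den c d \<theta> x y" if "\<theta> \<in> \<Theta>\<^sub>0" for \<theta> y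
    using that core_pmfs_nonneg[of "den c d \<theta> x" m \<theta> x]
    by (simp add: is_unique_arg_min_def is_arg_min_def)
qed (use assms in \<open>simp_all add: valid_construction_def\<close>)

lemma sample_spaceD:
  assumes "w \<in> space (sample_space m I)"
  shows "i \<in> I \<Longrightarrow> fst (w i) \<in> outcomes m" and "i \<in> I \<Longrightarrow> snd (w i) \<in> covariates m"
    and "J \<subseteq> I \<Longrightarrow> restrict w J \<in> space (sample_space m J)"
  using assms by (auto simp: sample_space_def obs_space_def space_PiM space_pair_measure
      space_restrict_space PiE_iff mem_Times_iff subset_iff)

text \<open>Zero denominators are allowed: inversion in \<open>ennreal\<close> is multiplicative on
  finite values, as the case of 0 times infinity cannot occur among them.\<close>

lemma prod_divide_ennreal:
  fixes a b :: "'i \<Rightarrow> real"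
  assumes "\<And>i. i \<in> I \<Longrightarrow> 0 \<le> a i" and "\<And>i. i \<in> I \<Longrightarrow> 0 \<le> b i"
  shows "(\<Prod>i\<in>I. ennreal (a i) / ennreal (b i)) = ennreal (prod a I) / ennreal (prod b I)"
  using assms
proof (induction I rule: infinite_finite_induct)
  case (insert i I)
  then show ?case
    by (simp add: ennreal_mult prod_nonneg divide_ennreal_def ennreal_inverse_mult mult_ac)
qed simp_all

lemma ennreal_inverse_antimono:
  fixes a b :: ennreal
  assumes "a \<le> b"
  shows "inverse b \<le> inverse a"
proof (cases a b rule: ennreal2_cases)
  case (real_real r s)
  then show ?thesis
    using assms by (cases "r = 0") (auto simp: inverse_ennreal intro!: ennreal_leI le_imp_inverse_le)
qed (use assms in \<open>auto simp: top_unique\<close>)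

text \<open>\<open>est_null\<close> maximizes the denominator over the null set, so putting a fixed
  \<theta> in its place can only raise the ratio. This removes the estimator that depends on the
  evaluation data and leaves a product over observations.\<close>

lemma lr_stat_le_lr_at:
  fixes m :: "('t, 'x::euclidean_space, 'u::euclidean_space, 'y::euclidean_space) model"
  assumes v: "valid_construction m \<Theta>\<^sub>0 D0 D1 c" and \<theta>: "\<theta> \<in> \<Theta>\<^sub>0"
    and w: "w \<in> space (sample_space m (D0 \<union> D1))"
  shows "lr_stat D0 D1 c w \<le> lr_at D0 D1 c \<theta> w"
proof -
  define d where "d = restrict w D1"
  have d: "d \<in> space (sample_space m D1)" using sample_spaceD(3)[OF w] by (simp add: d_def)
  have w': "fst (w i) \<in> outcomes m" "snd (w i) \<in> covariates m" if "i \<in> D0" for i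
    using sample_spaceD[OF w] that by auto
  have "is_arg_max (\<lambda>\<theta>. likelihood D0 w (den c d \<theta>)) (\<lambda>\<theta>. \<theta> \<in> \<Theta>\<^sub>0) (est_null c w)"
    using v w by (simp add: valid_construction_def d_def)
  then have "likelihood D0 w (den c d \<theta>) \<le> likelihood D0 w (den c d (est_null c w))"
    using \<theta> by (auto simp: is_arg_max_def not_less)
  then have "lr_stat D0 D1 c w \<le>
      ennreal (likelihood D0 w (num c d)) / ennreal (likelihood D0 w (den c d \<theta>))"
    by (auto simp: lr_stat_def d_def divide_ennreal_def intro!: mult_left_mono ennreal_inverse_antimono ennreal_leI)
  also have "\<dots> = lr_at D0 D1 c \<theta> w"
    using valid_constructionD[OF v d] w' \<theta>
    by (auto simp: lr_at_def likelihood_def d_def[symmetric] less_imp_le intro!: prod_divide_ennreal[symmetric])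
  finally show ?thesis .
qed

lemma measurable_ratio:
  fixes m :: "('t, 'x::euclidean_space, 'u::euclidean_space, 'y::euclidean_space) model"
  assumes fin: "finite (outcomes m)" and v: "valid_construction m \<Theta>\<^sub>0 D0 D1 c" and \<theta>: "\<theta> \<in> \<Theta>\<^sub>0"
  shows "(\<lambda>(d, z). ennreal (num c d (snd z) (fst z)) / ennreal (den c d \<theta> (snd z) (fst z)))
    \<in> borel_measurable (sample_space m D1 \<Otimes>\<^sub>M obs_space m)"
proof (rule measurable_obs_cases[OF fin])
  fix y assume "y \<in> outcomes m"
  then have
    "(\<lambda>(d, x). num c d x y) \<in> borel_measurable (sample_space m D1 \<Otimes>\<^sub>M borel_on (covariates m))"
    "(\<lambda>(d, x). den c d \<theta> x y) \<in> borel_measurable (sample_space m D1 \<Otimes>\<^sub>M borel_on (covariates m))"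
    using v \<theta> by (auto simp: valid_construction_def)
  then show "(\<lambda>(d, x). ennreal (num c d x y) / ennreal (den c d \<theta> x y))
      \<in> borel_measurable (sample_space m D1 \<Otimes>\<^sub>M borel_on (covariates m))"
    unfolding case_prod_unfold by measurable
qed

lemma measurable_lr_at:
  fixes m :: "('t, 'x::euclidean_space, 'u::euclidean_space, 'y::euclidean_space) model"
  assumes fin: "finite (outcomes m)" and v: "valid_construction m \<Theta>\<^sub>0 D0 D1 c" and \<theta>: "\<theta> \<in> \<Theta>\<^sub>0"
  shows "lr_at D0 D1 c \<theta> \<in> borel_measurable (sample_space m (D0 \<union> D1))"
proof -
  have "(\<lambda>w. (restrict w D1, w i)) \<in>
      sample_space m (D0 \<union> D1) \<rightarrow>\<^sub>M sample_space m D1 \<Otimes>\<^sub>M obs_space m" if "i \<in> D0" for i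
    unfolding sample_space_def using that
    by (intro measurable_Pair measurable_restrict_subset measurable_component_singleton) auto
  from measurable_compose[OF this measurable_ratio[OF fin v \<theta>]]
  show ?thesis
    unfolding lr_at_def by (intro borel_measurable_prod_ennreal) simp
qed

text \<open>With the training data frozen, condition on the covariate: the outcome law lies in the
  core at each x, so \<open>lfp_ratio_bound\<close> bounds the inner sum by 1 whatever the law of
  the covariate is.\<close>

lemma conditional_ratio_le_one:
  fixes m :: "('t, 'x::euclidean_space, 'u::euclidean_space, 'y::euclidean_space) model"
  assumes m: "incomplete_model m" and \<theta>: "\<theta> \<in> params m" "\<theta> \<in> \<Theta>\<^sub>0"
    and v: "valid_construction m \<Theta>\<^sub>0 D0 D1 c" and d: "d \<in> space (sample_space m D1)"
    and P: "P \<in> space (prob_algebra (obs_space m))"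
    and K: "is_cond_law m P K" "\<forall>x\<in>covariates m. K x \<in> core m \<theta> x"
  shows "(\<integral>\<^sup>+z. ennreal (num c d (snd z) (fst z)) / ennreal (den c d \<theta> (snd z) (fst z)) \<partial>P) \<le> 1"
proof -
  define h where "h y x = ennreal (num c d x y) / ennreal (den c d \<theta> x y)" for y x
  have fin: "finite (outcomes m)" using m by (simp add: incomplete_model_def)
  have "h y \<in> borel_measurable (borel_on (covariates m))" if y: "y \<in> outcomes m" for y
  proof -
    have "(\<lambda>(d, x). num c d x y) \<in> borel_measurable (sample_space m D1 \<Otimes>\<^sub>M borel_on (covariates m))"
      "(\<lambda>(d, x). den c d \<theta> x y) \<in> borel_measurable (sample_space m D1 \<Otimes>\<^sub>M borel_on (covariates m))"
      using v \<theta> y by (auto simp: valid_construction_def)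
    from this[THEN measurable_compose[OF measurable_Pair1'[OF d]]]
    show ?thesis by (simp add: h_def[abs_def])
  qed
  from nn_integral_cond_law[OF fin P K(1) this]
  have "(\<integral>\<^sup>+z. h (fst z) (snd z) \<partial>P) =
    (\<integral>\<^sup>+x. (\<Sum>y\<in>outcomes m. emeasure (K x) {y} * h y x) \<partial>distr P (borel_on (covariates m)) snd)" .
  also have "\<dots> \<le> (\<integral>\<^sup>+x. 1 \<partial>distr P (borel_on (covariates m)) snd)"
  proof (rule nn_integral_mono)
    fix x assume "x \<in> space (distr P (borel_on (covariates m)) snd)"
    then have x: "x \<in> covariates m" by (simp add: space_restrict_space)
    then have Kx: "K x \<in> core m \<theta> x" using K by blast
    then interpret prob_space "K x" by (simp add: core_def space_prob_algebra)
    have "sum (num c d x) (outcomes m) = 1"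
      using valid_constructionD(1)[OF v d x] unfolding core_pmfs_iff[OF fin] by blast
    moreover have "(\<lambda>y. prob {y}) \<in> core_pmfs m \<theta> x" using Kx by (auto simp: core_pmfs_def)
    ultimately show "(\<Sum>y\<in>outcomes m. emeasure (K x) {y} * h y x) \<le> 1"
      using lfp_ratio_bound[OF m \<theta>(1) x valid_constructionD(2)[OF v d x] _
          valid_constructionD(3)[OF v d x \<theta>(2)]]
      by (simp add: emeasure_eq_measure h_def)
  qed
  also have "\<dots> = 1"
  proof -
    interpret prob_space P using P by (simp add: space_prob_algebra)
    have "snd \<in> P \<rightarrow>\<^sub>M borel_on (covariates m)"
      using P by (simp add: space_prob_algebra obs_space_def cong: measurable_cong_sets)
    then interpret D: prob_space "distr P (borel_on (covariates m)) snd" by (rule prob_space_distr)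
    show ?thesis using D.emeasure_space_1 by simp
  qed
  finally show ?thesis by (simp add: h_def)
qed

lemma prod_le_one_ennreal:
  fixes f :: "'i \<Rightarrow> ennreal"
  assumes "\<And>i. i \<in> I \<Longrightarrow> f i \<le> 1"
  shows "prod f I \<le> 1"
  using assms
proof (induction I rule: infinite_finite_induct)
  case (insert i I)
  then show ?case using mult_mono[of "f i" 1 "prod f I" 1] by simp
qed simp_all

text \<open>By Fubini the evaluation part is integrated first. For frozen training data the
  integrand is a product of functions of single coordinates, so its integral is a product of numbers
  that are at most 1.\<close>

lemma nn_integral_lr_at_le_one:
  fixes m :: "('t, 'x::euclidean_space, 'u::euclidean_space, 'y::euclidean_space) model"
  assumes m: "incomplete_model m" and \<theta>: "\<theta> \<in> params m" "\<theta> \<in> \<Theta>\<^sub>0"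
    and v: "valid_construction m \<Theta>\<^sub>0 D0 D1 c"
    and D: "finite D0" "finite D1" "D0 \<inter> D1 = {}"
    and Q: "\<And>i. i \<in> D0 \<union> D1 \<Longrightarrow> Q i \<in> space (prob_algebra (obs_space m))"
      "\<And>i. i \<in> D0 \<union> D1 \<Longrightarrow> \<exists>K. is_cond_law m (Q i) K \<and> (\<forall>x\<in>covariates m. K x \<in> core m \<theta> x)"
  shows "(\<integral>\<^sup>+w. lr_at D0 D1 c \<theta> w \<partial>(\<Pi>\<^sub>M i\<in>D0 \<union> D1. Q i)) \<le> 1"
proof -
  \<comment> \<open>The product locale wants a probability measure at every index, so a point mass
    is placed outside the sample.\<close>
  define M where "M i = (if i \<in> D0 \<union> D1 then Q i else return (count_space UNIV) undefined)" for i
  have fin: "finite (outcomes m)" using m by (simp add: incomplete_model_def)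
  have prob: "prob_space (M i)" for i
    using Q(1)[of i] by (simp add: M_def space_prob_algebra prob_space_return)
  interpret product_prob_space M by (rule product_prob_spaceI[OF prob])
  have setsM: "sets (M i) = sets (obs_space m)" if "i \<in> D0 \<union> D1" for i
    using that Q(1)[OF that] by (simp add: M_def space_prob_algebra)
  have sets: "sets (PiM J M) = sets (sample_space m J)" if "J \<subseteq> D0 \<union> D1" for J
    unfolding sample_space_def using that by (intro sets_PiM_cong refl setsM) auto
  have meas: "lr_at D0 D1 c \<theta> \<in> borel_measurable (PiM (D1 \<union> D0) M)"
    using measurable_lr_at[OF fin v \<theta>(2)] sets[of "D1 \<union> D0"]
    by (simp add: Un_commute cong: measurable_cong_sets)
  have "(\<integral>\<^sup>+w. lr_at D0 D1 c \<theta> w \<partial>(\<Pi>\<^sub>M i\<in>D0 \<union> D1. Q i)) =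
      (\<integral>\<^sup>+w. lr_at D0 D1 c \<theta> w \<partial>PiM (D1 \<union> D0) M)"
    by (intro arg_cong2[where f = nn_integral] PiM_cong refl) (auto simp: M_def)
  also have "\<dots> = (\<integral>\<^sup>+d. \<integral>\<^sup>+y. lr_at D0 D1 c \<theta> (merge D1 D0 (d, y)) \<partial>PiM D0 M \<partial>PiM D1 M)"
    using D by (intro product_nn_integral_fold meas) auto
  also have "\<dots> \<le> (\<integral>\<^sup>+d. 1 \<partial>PiM D1 M)"
  proof (rule nn_integral_mono)
    fix d assume "d \<in> space (PiM D1 M)"
    then have d: "d \<in> space (sample_space m D1)" using sets_eq_imp_space_eq[OF sets[of D1]] by simp
    define g where "g z = ennreal (num c d (snd z) (fst z)) / ennreal (den c d \<theta> (snd z) (fst z))" for z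
    \<comment> \<open>The training data, and hence both densities, do not change as \<open>y\<close>
      varies.\<close>
    have "restrict (merge D1 D0 (d, y)) D1 = d" for y
      using d by (auto simp: merge_def sample_space_def space_PiM PiE_iff extensional_def restrict_def)
    then have "lr_at D0 D1 c \<theta> (merge D1 D0 (d, y)) = (\<Prod>i\<in>D0. g (y i))" for y
      using D(3) by (auto simp: lr_at_def g_def merge_def intro!: prod.cong)
    then have "(\<integral>\<^sup>+y. lr_at D0 D1 c \<theta> (merge D1 D0 (d, y)) \<partial>PiM D0 M) =
        (\<integral>\<^sup>+y. (\<Prod>i\<in>D0. g (y i)) \<partial>PiM D0 M)" by simp
    also have "\<dots> = (\<Prod>i\<in>D0. integral\<^sup>N (M i) g)"
    proof (rule product_nn_integral_prod[OF D(1)])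
      fix i assume i: "i \<in> D0"
      have "g \<in> borel_measurable (obs_space m)"
        using measurable_compose[OF measurable_Pair1'[OF d] measurable_ratio[OF fin v \<theta>(2)]]
        by (simp add: g_def[abs_def])
      then show "g \<in> borel_measurable (M i)"
        using setsM[of i] i by (simp cong: measurable_cong_sets)
    qed
    also have "\<dots> \<le> 1"
    proof (rule prod_le_one_ennreal)
      fix i assume i: "i \<in> D0"
      then obtain K where "is_cond_law m (Q i) K" "\<forall>x\<in>covariates m. K x \<in> core m \<theta> x"
        using Q(2)[of i] by auto
      from conditional_ratio_le_one[OF m \<theta> v d _ this] show "integral\<^sup>N (M i) g \<le> 1"
        using Q(1)[of i] i by (simp add: M_def g_def[abs_def])
    qed
    finally show "(\<integral>\<^sup>+y. lr_at D0 D1 c \<theta> (merge D1 D0 (d, y)) \<partial>PiM D0 M) \<le> 1" .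
  qed
  also have "\<dots> = 1"
  proof -
    interpret D: prob_space "PiM D1 M" by (rule prob_space_PiM[OF prob])
    show ?thesis using D.emeasure_space_1 by simp
  qed
  finally show ?thesis .
qed

section \<open>The level of the cross-fit test\<close>

theorem theorem1:
  fixes m :: "('t, 'x::euclidean_space, 'u::euclidean_space, 'y::euclidean_space) model"
    and \<Theta>\<^sub>0 :: "'t set" and \<alpha> :: real and n :: nat and D0 D1 :: "nat set"
    and c c' :: "('t, 'x, 'y) split_construction"
  assumes "incomplete_model m"
    and "\<Theta>\<^sub>0 \<subseteq> params m"
    and "0 < \<alpha>" and "\<alpha> < 1"
    and "D0 \<union> D1 = {1..n}" and "D0 \<inter> D1 = {}"
    and "valid_construction m \<Theta>\<^sub>0 D0 D1 c"
    and "valid_construction m \<Theta>\<^sub>0 D1 D0 c'"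
  shows "(SUP P \<in> {P \<in> null_dgps m \<Theta>\<^sub>0 n.
                     \<exists>Q\<in>full_laws m n. observed_law m n Q = P \<and>
                        independent_units m n Q \<and> identical_covariates_latents m n Q}.
            emeasure P {w \<in> space P. cross_fit_stat D0 D1 c c' w > ennreal (1 / \<alpha>)}) \<le> ennreal \<alpha>"
proof (rule SUP_least)
  fix P assume "P \<in> {P \<in> null_dgps m \<Theta>\<^sub>0 n.
    \<exists>Q'\<in>full_laws m n. observed_law m n Q' = P \<and>
      independent_units m n Q' \<and> identical_covariates_latents m n Q'}"
  then obtain \<theta> Q where \<theta>: "\<theta> \<in> \<Theta>\<^sub>0"
    and P: "P \<in> space (prob_algebra (sample_space m {1..n}))" "P = (\<Pi>\<^sub>M i\<in>{1..n}. Q i)"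
    and Q: "\<And>i. i \<in> {1..n} \<Longrightarrow> Q i \<in> space (prob_algebra (obs_space m))"
      "\<And>i. i \<in> {1..n} \<Longrightarrow> \<exists>K. is_cond_law m (Q i) K \<and> (\<forall>x\<in>covariates m. K x \<in> core m \<theta> x)"
    unfolding null_dgps_def dgps_def by blast
  have \<theta>': "\<theta> \<in> params m" using \<theta> assms(2) by blast
  have fin: "finite (outcomes m)" using assms(1) by (simp add: incomplete_model_def)
  have U: "D0 \<union> D1 = {1..n}" "D1 \<union> D0 = {1..n}" using assms(5) by auto
  have D: "finite D0" "finite D1" "D0 \<inter> D1 = {}" "D1 \<inter> D0 = {}"
    using U(1) assms(6) finite_subset[of _ "{1..n}"] by auto
  have sP: "sets P = sets (sample_space m {1..n})" using P by (simp add: space_prob_algebra)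
  \<comment> \<open>The ratios at the true \<theta>, one for each direction of the split; they bound
    the two halves of the statistic.\<close>
  define R where "R w = lr_at D0 D1 c \<theta> w" for w
  define R' where "R' w = lr_at D1 D0 c' \<theta> w" for w
  have [measurable]: "R \<in> borel_measurable P" "R' \<in> borel_measurable P"
    using measurable_lr_at[OF fin assms(7) \<theta>] measurable_lr_at[OF fin assms(8) \<theta>]
    by (simp_all add: U R_def[abs_def] R'_def[abs_def] sP cong: measurable_cong_sets)
  have R: "(\<integral>\<^sup>+w. R w \<partial>P) \<le> 1" "(\<integral>\<^sup>+w. R' w \<partial>P) \<le> 1"
    using nn_integral_lr_at_le_one[OF assms(1) \<theta>' \<theta> assms(7) D(1-3), of Q]
      nn_integral_lr_at_le_one[OF assms(1) \<theta>' \<theta> assms(8) D(2,1,4), of Q] Q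
    by (simp_all add: U P(2) R_def R'_def)
  have "emeasure P {w \<in> space P. cross_fit_stat D0 D1 c c' w > ennreal (1 / \<alpha>)}
      \<le> emeasure P {w \<in> space P. 1 \<le> ennreal \<alpha> * ((R w + R' w) / 2)}"
  proof (rule emeasure_mono)
    show "{w \<in> space P. cross_fit_stat D0 D1 c c' w > ennreal (1 / \<alpha>)}
        \<subseteq> {w \<in> space P. 1 \<le> ennreal \<alpha> * ((R w + R' w) / 2)}"
    proof safe
      fix w assume "w \<in> space P" and big: "cross_fit_stat D0 D1 c c' w > ennreal (1 / \<alpha>)"
      then have w: "w \<in> space (sample_space m {1..n})" using sets_eq_imp_space_eq[OF sP] by simp
      have "cross_fit_stat D0 D1 c c' w \<le> (R w + R' w) / 2"
        unfolding cross_fit_stat_def R_def R'_def using w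
        by (intro divide_right_mono_ennreal add_mono lr_stat_le_lr_at[OF assms(7) \<theta>]
            lr_stat_le_lr_at[OF assms(8) \<theta>]) (simp_all add: U)
      with big have "ennreal (1 / \<alpha>) \<le> (R w + R' w) / 2" by simp
      \<comment> \<open>Scaling by \<alpha> gives the event the form that Markov's inequality
        expects.\<close>
      then have "ennreal \<alpha> * ennreal (1 / \<alpha>) \<le> ennreal \<alpha> * ((R w + R' w) / 2)"
        by (rule mult_left_mono) simp
      then show "1 \<le> ennreal \<alpha> * ((R w + R' w) / 2)"
        using assms(3) by (simp flip: ennreal_mult)
    qed
  qed measurable
  also have "\<dots> \<le> ennreal \<alpha> * (\<integral>\<^sup>+w. (R w + R' w) / 2 * indicator (space P) w \<partial>P)"
    by (rule nn_integral_Markov_inequality) auto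
  \<comment> \<open>The two directions share the data and are dependent, but only additivity of the
    mean is used.\<close>
  also have "\<dots> = ennreal \<alpha> * (((\<integral>\<^sup>+w. R w \<partial>P) + (\<integral>\<^sup>+w. R' w \<partial>P)) / 2)"
    by (simp add: nn_integral_divide nn_integral_add cong: nn_integral_cong)
  also have "\<dots> \<le> ennreal \<alpha> * ((1 + 1) / 2)"
    using R by (intro mult_left_mono divide_right_mono_ennreal add_mono) auto
  also have "\<dots> = ennreal \<alpha>"
    using ennreal_divide_self[of 2] by simp
  finally show "emeasure P {w \<in> space P. cross_fit_stat D0 D1 c c' w > ennreal (1 / \<alpha>)} \<le> ennreal \<alpha>" .
qed

end
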